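(* Let $T$ be a tree (of arbitrary finite or infinite order). Then the following statements are equivalent: (i) The inclusion $U(T) \subseteq \mathbf{US}$ holds. (ii) The inequality $|E(P)| \leq 3$ holds for every path $P \subseteq T$. (iii) There exist at most two distinct vertices $u, v \in V(T)$ such that $\deg u \geq 2$ and $\deg v \geq 2$ (that is, $T$ contains at most two vertices of degree at least two).
   Context: $\mathbb{R}^+ = [0,\infty)$. A (simple) graph is a pair $G=(V(G),E(G))$ with $V(G)$ a nonempty set (possibly infinite) and $E(G)$ a set of two-point subsets of $V(G)$. The degree $\deg v$ of a vertex $v$ is the cardinality of $\{u \in V(G) : \{u,v\}\in E(G)\}$. A path is a finite graph $P$ whose vertices can be numbered without repetition as $v_1,\dots,v_k$, $k\ge 2$, with $E(P)=\{\{v_1,v_2\},\dots,\{v_{k-1},v_k\}\}$; it joins $v_1$ and $v_k$. $P\subseteq G$ means that $P$ is a subgraph of $G$. A cycle is a finite graph with at least three vertices, which can be numbered without repetition as $v_1,\dots,v_n$ so that the edge set is $\{\{v_1,v_2\},\dots,\{v_{n-1},v_n\},\{v_n,v_1\}\}$. A graph is connected if every two distinct vertices are joined by a path in it. A tree is a connected graph without cycles. An ultrametric on a nonempty set $X$ is a function $d\colon X\times X\to\mathbb{R}^+$ that is symmetric, satisfies $d(x,y)=0 \iff x=y$, and satisfies $d(x,y)\le\max\{d(x,z),d(z,y)\}$ for all $x,y,z\in X$. For a tree $T$ and a vertex labeling $l\colon V(T)\to\mathbb{R}^+$, define $d_l\colon V(T)\times V(T)\to\mathbb{R}^+$ by $d_l(u,u)=0$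 and, for $u\ne v$, $d_l(u,v)=\max_{w\in V(P)} l(w)$, where $P$ is the unique path joining $u$ and $v$ in $T$. The labeling $l$ is non-degenerate if $\max\{l(u),l(v)\}>0$ for every $\{u,v\}\in E(T)$; it is known that $d_l$ is an ultrametric on $V(T)$ if and only if $l$ is non-degenerate. Let $L(T)$ be the set of all non-degenerate labelings of $V(T)$, and $U(T):=\{(V(T),d_l) : l\in L(T)\}$. A star graph is a tree $S$ for which there is a vertex $c\in V(S)$ adjacent to every vertex of $V(S)\setminus\{c\}$, with no other edges. $\mathbf{US}$ denotes the class of all ultrametric spaces generated by labeled star graphs, i.e. all ultrametric spaces $(X,d)$ for which there exist a star graph $S$ with $V(S)=X$ and a labeling $l\colon V(S)\to\mathbb{R}^+$ such that $d=d_l$. *)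

theory Defs
  imports Complex_Main "HOL-Library.FuncSet" "HOL-Library.Extended_Nat"
begin

record 'a sgraph =
  vertices :: "'a set"
  edges :: "'a set set"

definition simple_graph :: "'a sgraph \<Rightarrow> bool" where
  "simple_graph G \<longleftrightarrow>
     vertices G \<noteq> {} \<and>
     edges G \<subseteq> {{u, v} | u v. u \<in> vertices G \<and> v \<in> vertices G \<and> u \<noteq> v}"

definition is_subgraph :: "'a sgraph \<Rightarrow> 'a sgraph \<Rightarrow> bool" where
  "is_subgraph H G \<longleftrightarrow>
     simple_graph H \<and> simple_graph G \<and> vertices H \<subseteq> vertices G \<and> edges H \<subseteq> edges G"

(* The degree is an extended natural number because card is 0 on infinite sets;
   all infinite cardinalities are identified with \<infinity>. *)
definition vertex_degree :: "'a sgraph \<Rightarrow> 'a \<Rightarrow> enat" where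
  "vertex_degree G v =
     (let N = {u \<in> vertices G. {u, v} \<in> edges G}
      in if finite N then enat (card N) else \<infinity>)"

definition path_numbering :: "'a sgraph \<Rightarrow> 'a list \<Rightarrow> bool" where
  "path_numbering P vs \<longleftrightarrow>
     distinct vs \<and> length vs \<ge> 2 \<and> vertices P = set vs \<and>
     edges P = {{vs ! i, vs ! Suc i} | i. Suc i < length vs}"

definition is_path :: "'a sgraph \<Rightarrow> bool" where
  "is_path P \<longleftrightarrow> (\<exists>vs. path_numbering P vs)"

definition path_joins :: "'a sgraph \<Rightarrow> 'a \<Rightarrow> 'a \<Rightarrow> bool" where
  "path_joins P u v \<longleftrightarrow> (\<exists>vs. path_numbering P vs \<and> hd vs = u \<and> last vs = v)"

definition is_cycle :: "'a sgraph \<Rightarrow> bool" where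
  "is_cycle C \<longleftrightarrow>
     (\<exists>vs. distinct vs \<and> length vs \<ge> 3 \<and> vertices C = set vs \<and>
           edges C = {{vs ! i, vs ! Suc i} | i. Suc i < length vs} \<union> {{last vs, hd vs}})"

definition connected_graph :: "'a sgraph \<Rightarrow> bool" where
  "connected_graph G \<longleftrightarrow>
     (\<forall>u\<in>vertices G. \<forall>v\<in>vertices G. u \<noteq> v \<longrightarrow> (\<exists>P. is_subgraph P G \<and> path_joins P u v))"

definition is_tree :: "'a sgraph \<Rightarrow> bool" where
  "is_tree T \<longleftrightarrow>
     simple_graph T \<and> connected_graph T \<and> \<not> (\<exists>C. is_cycle C \<and> is_subgraph C T)"

definition is_star_graph :: "'a sgraph \<Rightarrow> bool" where
  "is_star_graph S \<longleftrightarrow>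
     is_tree S \<and> (\<exists>c\<in>vertices S. edges S = {{c, v} | v. v \<in> vertices S - {c}})"

(* Functions on a set are represented by their extensional representatives
   (value undefined off the domain), so that equality of labelings and of
   metrics is equality as functions on the domain. *)

definition is_ultrametric :: "'a set \<Rightarrow> ('a \<times> 'a \<Rightarrow> real) \<Rightarrow> bool" where
  "is_ultrametric X d \<longleftrightarrow>
     X \<noteq> {} \<and> d \<in> X \<times> X \<rightarrow>\<^sub>E {0..} \<and>
     (\<forall>x\<in>X. \<forall>y\<in>X. d (x, y) = d (y, x)) \<and>
     (\<forall>x\<in>X. \<forall>y\<in>X. d (x, y) = 0 \<longleftrightarrow> x = y) \<and>
     (\<forall>x\<in>X. \<forall>y\<in>X. \<forall>z\<in>X. d (x, y) \<le> max (d (x, z)) (d (z, y)))"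

definition labelings :: "'a sgraph \<Rightarrow> ('a \<Rightarrow> real) set" where
  "labelings G = vertices G \<rightarrow>\<^sub>E {0..}"

definition nondegenerate_labelings :: "'a sgraph \<Rightarrow> ('a \<Rightarrow> real) set" where
  "nondegenerate_labelings T =
     {l \<in> labelings T. \<forall>u v. {u, v} \<in> edges T \<longrightarrow> max (l u) (l v) > 0}"

definition tree_path :: "'a sgraph \<Rightarrow> 'a \<Rightarrow> 'a \<Rightarrow> 'a sgraph" where
  "tree_path T u v = (THE P. is_subgraph P T \<and> path_joins P u v)"

definition label_dist :: "'a sgraph \<Rightarrow> ('a \<Rightarrow> real) \<Rightarrow> 'a \<times> 'a \<Rightarrow> real" where
  "label_dist T l =
     (\<lambda>(u, v) \<in> vertices T \<times> vertices T.
        if u = v then 0 else Max (l ` vertices (tree_path T u v)))"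

definition generated_spaces :: "'a sgraph \<Rightarrow> ('a set \<times> ('a \<times> 'a \<Rightarrow> real)) set" where
  "generated_spaces T = {(vertices T, label_dist T l) | l. l \<in> nondegenerate_labelings T}"

(* The star has the points of the space as its vertices, so restricting the class to
   spaces with points in the type 'a does not affect which of these belong to it. *)
definition star_generated_spaces :: "('a set \<times> ('a \<times> 'a \<Rightarrow> real)) set" where
  "star_generated_spaces =
     {(X, d). is_ultrametric X d \<and>
        (\<exists>S l. is_star_graph S \<and> vertices S = X \<and> l \<in> labelings S \<and> d = label_dist S l)}"

end

theory Submission
  imports Defs
begin

text \<open>
  If \<open>v\<^sub>0, \<dots>, v\<^sub>4\<close> is a path, give \<open>v\<^sub>2\<close> the label 2 and every other vertex the label 1. Then
  \<open>v\<^sub>0, v\<^sub>1\<close> and \<open>v\<^sub>3, v\<^sub>4\<close> are pairs at distance 1 while \<open>v\<^sub>0, v\<^sub>3\<close> are at distance 2, which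
  is impossible in a space generated by a star with centre \<open>c\<close>, where distinct points satisfy
  \<open>d(u, v) = max {l(u), l(v), l(c)}\<close>.

  A path joining two vertices of degree at least two can be prolonged at both ends, so when all
  paths have at most three edges these vertices are adjacent, and a tree contains no three
  pairwise adjacent vertices.

  Suppose finally that at most two vertices have degree at least two, and let \<open>c\<close> be the one with
  the smaller label. The labeling \<open>u \<mapsto> d\<^sub>l(u, c)\<close> (and \<open>c \<mapsto> l(c)\<close>) of the star centred at \<open>c\<close>
  generates the space \<open>d\<^sub>l\<close>.
\<close>

section \<open>Paths as vertex lists\<close>

definition vertex_path :: "'a sgraph \<Rightarrow> 'a list \<Rightarrow> bool" where
  "vertex_path G xs \<longleftrightarrow>
     distinct xs \<and> set xs \<subseteq> vertices G \<and> successively (\<lambda>x y. {x, y} \<in> edges G) xs"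

lemma vertex_path_rev: "vertex_path G (rev xs) \<longleftrightarrow> vertex_path G xs"
  by (simp add: vertex_path_def insert_commute)

lemma vertex_path_appendD:
  assumes "vertex_path G (xs @ ys)"
  shows "vertex_path G xs" "vertex_path G ys"
  using assms by (auto simp: vertex_path_def successively_append_iff)

lemma simple_graph_edgeD:
  assumes "simple_graph G" "{x, y} \<in> edges G"
  shows "x \<in> vertices G" "y \<in> vertices G" "x \<noteq> y"
proof -
  obtain u v where "{x, y} = {u, v}" "u \<in> vertices G" "v \<in> vertices G" "u \<noteq> v"
    using assms unfolding simple_graph_def by blast
  then show "x \<in> vertices G" "y \<in> vertices G" "x \<noteq> y"
    by (auto simp: doubleton_eq_iff)
qed

lemma path_numbering_subgraph:
  assumes "path_numbering P vs" "is_subgraph P G"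
  shows "vertex_path G vs" "2 \<le> length vs"
proof -
  have "{vs ! i, vs ! Suc i} \<in> edges G" if "Suc i < length vs" for i
  proof -
    have "{vs ! i, vs ! Suc i} \<in> edges P"
      using assms(1) that unfolding path_numbering_def by blast
    then show ?thesis using assms(2) unfolding is_subgraph_def by blast
  qed
  then show "vertex_path G vs" "2 \<le> length vs"
    using assms by (auto simp: vertex_path_def path_numbering_def is_subgraph_def
        successively_conv_nth)
qed

lemma vertex_path_subgraph:
  assumes G: "simple_graph G" and vs: "vertex_path G vs" "2 \<le> length vs"
  obtains P where "path_numbering P vs" "is_subgraph P G"
proof -
  define P where "P = \<lparr>vertices = set vs, edges = {{vs ! i, vs ! Suc i} | i. Suc i < length vs}\<rparr>"
  have "path_numbering P vs"
    using vs by (simp add: P_def path_numbering_def vertex_path_def)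
  moreover have "edges P \<subseteq> edges G"
    using vs by (auto simp: P_def vertex_path_def successively_conv_nth)
  moreover have "simple_graph P"
    using vs unfolding simple_graph_def P_def vertex_path_def
    by (fastforce simp: nth_eq_iff_index_eq intro: nth_mem)
  ultimately show ?thesis
    using that G vs by (simp add: is_subgraph_def P_def vertex_path_def)
qed

text \<open>Two consecutive pairs with equal vertex sets agree either in order, so their indices
  coincide, or crosswise, which would put each index one above the other.\<close>

lemma card_edges_path:
  assumes "path_numbering P vs"
  shows "card (edges P) = length vs - 1"
proof -
  have "edges P = (\<lambda>i. {vs ! i, vs ! Suc i}) ` {..<length vs - 1}"
    using assms by (auto simp: path_numbering_def)
  moreover have "inj_on (\<lambda>i. {vs ! i, vs ! Suc i}) {..<length vs - 1}"
    using assms by (auto simp: inj_on_def path_numbering_def doubleton_eq_iff nth_eq_iff_index_eq)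
  ultimately show ?thesis by (simp add: card_image)
qed

text \<open>Turns condition (ii) into a bound on lists: three edges mean four vertices, and lists
  that are too short to number a path satisfy the bound trivially.\<close>

lemma paths_at_most_three_edges_iff:
  assumes "simple_graph G"
  shows "(\<forall>P. is_path P \<and> is_subgraph P G \<longrightarrow> card (edges P) \<le> 3) \<longleftrightarrow>
         (\<forall>vs. vertex_path G vs \<longrightarrow> length vs \<le> 4)"  (is "?L \<longleftrightarrow> ?R")
proof
  assume L: ?L
  show ?R
  proof (intro allI impI)
    fix vs assume vs: "vertex_path G vs"
    show "length vs \<le> 4"
    proof (cases "2 \<le> length vs")
      case True
      then obtain P where P: "path_numbering P vs" "is_subgraph P G"
        using vertex_path_subgraph assms vs by blast
      then have "card (edges P) \<le> 3" using L unfolding is_path_def by blast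
      then show ?thesis using card_edges_path[OF P(1)] by simp
    qed simp
  qed
next
  assume R: ?R
  show ?L
  proof (intro allI impI)
    fix P assume P: "is_path P \<and> is_subgraph P G"
    then obtain vs where vs: "path_numbering P vs" unfolding is_path_def by blast
    then have "length vs \<le> 4" using P R path_numbering_subgraph by blast
    then show "card (edges P) \<le> 3" using card_edges_path[OF vs] by simp
  qed
qed

section \<open>Paths and distances in trees\<close>

text \<open>Adding the closing edge to the path would yield a cycle. With two vertices the closing
  edge would be the edge of the path itself, hence the bound 3.\<close>

lemma tree_no_closed_path:
  assumes T: "is_tree T" and zs: "vertex_path T zs" "3 \<le> length zs"
  shows "{last zs, hd zs} \<notin> edges T"
proof
  assume e: "{last zs, hd zs} \<in> edges T"
  obtain P where P: "path_numbering P zs" "is_subgraph P T"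
    using vertex_path_subgraph[of T zs] T zs unfolding is_tree_def by auto
  define C where "C = \<lparr>vertices = set zs, edges = edges P \<union> {{last zs, hd zs}}\<rparr>"
  have "is_cycle C"
    unfolding is_cycle_def using P(1) zs
    by (intro exI[of _ zs]) (auto simp: C_def path_numbering_def)
  moreover have "is_subgraph C T"
  proof -
    have "last zs \<noteq> hd zs" using simple_graph_edgeD[of T] T e unfolding is_tree_def by blast
    moreover have "last zs \<in> set zs" "hd zs \<in> set zs" using zs(2) by (auto intro: last_in_set hd_in_set)
    ultimately have "simple_graph C"
      using P unfolding simple_graph_def is_subgraph_def C_def path_numbering_def by auto
    then show ?thesis
      using P e by (auto simp: is_subgraph_def C_def path_numbering_def)
  qed
  ultimately show False using T unfolding is_tree_def by blast
qed

text \<open>Induction strips the common first vertex \<open>u\<close>. If the paths part right after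
  \<open>u\<close>, following one until it first meets the other and returning along the latter
  closes a cycle through \<open>u\<close>.\<close>

lemma tree_path_unique:
  assumes "is_tree T"
  shows "\<lbrakk>vertex_path T xs; vertex_path T ys; xs \<noteq> []; ys \<noteq> []; hd xs = hd ys; last xs = last ys\<rbrakk>
         \<Longrightarrow> xs = ys"
proof (induction xs arbitrary: ys)
  case Nil
  then show ?case by simp
next
  case (Cons u xs)
  obtain ys' where ys: "ys = u # ys'" using Cons.prems by (cases ys) auto
  have dist: "distinct (u # xs)" "distinct (u # ys')"
    using Cons.prems ys by (auto simp: vertex_path_def)
  show ?case
  \<comment> \<open>If one path ends at \<open>u\<close>, so does the other, and by distinctness it
    has no further vertex.\<close>
  proof (cases "xs = [] \<or> ys' = []")
    case True
    then show ?thesis using Cons.prems ys dist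
      by (metis last_ConsL last_ConsR last_in_set distinct.simps(2))
  next
    case False
    then have ne: "xs \<noteq> []" "ys' \<noteq> []" by auto
    have p: "vertex_path T xs" "vertex_path T ys'"
      using Cons.prems ys vertex_path_appendD(2)[of T "[u]"] by auto
    have l: "last xs = last ys'" using Cons.prems(6) ys ne by simp
    have "hd xs = hd ys'"
    proof (rule ccontr)
      assume hd: "hd xs \<noteq> hd ys'"
      have "\<exists>x\<in>set xs. x \<in> set ys'" using l ne last_in_set by metis
      \<comment> \<open>Taking the first meeting point \<open>w\<close> makes \<open>A\<close>
        disjoint from \<open>ys'\<close>, so the closed walk repeats no vertex.\<close>
      then obtain A w B where A: "xs = A @ w # B" "w \<in> set ys'" "\<forall>x\<in>set A. x \<notin> set ys'"
        using split_list_first_propE[of xs "\<lambda>x. x \<in> set ys'"] by metis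
      then obtain C D where C: "ys' = C @ w # D" by (meson split_list)
      let ?zs = "u # A @ w # rev C"
      have "vertex_path T ?zs"
      proof -
        have "vertex_path T (u # A @ [w])"
          using Cons.prems(1) A(1) vertex_path_appendD(1)[of T "u # A @ [w]" B] by simp
        moreover have "vertex_path T (w # rev C)"
          using p(2) C vertex_path_appendD(1)[of T "C @ [w]" D] vertex_path_rev[of T "C @ [w]"]
          by simp
        moreover have "distinct ?zs" using dist A C by auto
        ultimately show ?thesis
          unfolding vertex_path_def
          by (auto simp: successively_append_iff successively_Cons hd_append split: if_splits)
      qed
      \<comment> \<open>\<open>A\<close> and \<open>C\<close> cannot both be empty, since then both
        tails would start with \<open>w\<close>.\<close>
      moreover have "3 \<le> length ?zs" using hd A(1) C by (cases A; cases C) auto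
      moreover have "{last ?zs, hd ?zs} \<in> edges T"
      proof -
        have "last ?zs = hd ys'" using C by (cases C) auto
        moreover have "{u, hd ys'} \<in> edges T"
          using Cons.prems(2) ys ne by (auto simp: vertex_path_def successively_Cons)
        ultimately show ?thesis by (simp add: insert_commute)
      qed
      ultimately show False using tree_no_closed_path[OF assms] by blast
    qed
    then show ?thesis using Cons.IH[OF p ne _ l] ys by simp
  qed
qed

lemma tree_connected:
  assumes "is_tree T" "u \<in> vertices T" "v \<in> vertices T" "u \<noteq> v"
  obtains vs where "vertex_path T vs" "2 \<le> length vs" "hd vs = u" "last vs = v"
proof -
  obtain P where "is_subgraph P T" "path_joins P u v"
    using assms unfolding is_tree_def connected_graph_def by blast
  then show ?thesis using that path_numbering_subgraph unfolding path_joins_def by metis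
qed

text \<open>By uniqueness, the description in \<open>tree_path\<close> denotes the graph numbered by
  \<open>vs\<close>; distances can thus be read off from any explicit vertex list.\<close>

lemma label_dist_path:
  assumes T: "is_tree T" and vs: "vertex_path T vs" "2 \<le> length vs"
  shows "label_dist T l (hd vs, last vs) = Max (l ` set vs)"
proof -
  obtain P where P: "path_numbering P vs" "is_subgraph P T"
    using vertex_path_subgraph[of T vs] T vs unfolding is_tree_def by auto
  have "tree_path T (hd vs) (last vs) = P"
    unfolding tree_path_def
  proof (rule the_equality)
    show "is_subgraph P T \<and> path_joins P (hd vs) (last vs)"
      using P unfolding path_joins_def by blast
  next
    fix Q assume Q: "is_subgraph Q T \<and> path_joins Q (hd vs) (last vs)"
    then obtain ws where ws: "path_numbering Q ws" "hd ws = hd vs" "last ws = last vs"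
      unfolding path_joins_def by blast
    then have "vertex_path T ws" "2 \<le> length ws" using Q path_numbering_subgraph by blast+
    then have "ws = vs" using tree_path_unique[OF T, of ws vs] vs ws by fastforce
    then show "Q = P" using P(1) ws(1) by (simp add: path_numbering_def)
  qed
  moreover have "hd vs \<noteq> last vs"
    using vs by (cases vs) (auto simp: vertex_path_def)
  moreover have "hd vs \<in> vertices T" "last vs \<in> vertices T"
    using vs by (auto simp: vertex_path_def intro!: subsetD[of "set vs" "vertices T"] hd_in_set last_in_set)
  ultimately show ?thesis
    using P(1) by (simp add: label_dist_def path_numbering_def)
qed

text \<open>The first edge of the joining path already carries a positive label.\<close>

lemma label_dist_pos:
  assumes T: "is_tree T" and l: "l \<in> nondegenerate_labelings T"
    and "u \<in> vertices T" "v \<in> vertices T" "u \<noteq> v"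
  shows "0 < label_dist T l (u, v)"
proof -
  obtain vs where vs: "vertex_path T vs" "2 \<le> length vs" "hd vs = u" "last vs = v"
    using tree_connected assms by metis
  then obtain x y zs where xy: "vs = x # y # zs" by (cases vs; cases "tl vs") auto
  then have "{x, y} \<in> edges T" using vs by (simp add: vertex_path_def)
  then have "0 < max (l x) (l y)" using l unfolding nondegenerate_labelings_def by blast
  also have "\<dots> \<le> Max (l ` set vs)" using xy by (intro max.boundedI Max_ge) auto
  finally show ?thesis using label_dist_path[OF T vs(1,2)] vs by simp
qed

section \<open>Vertices of degree at least two and short paths\<close>

text \<open>Removes extended naturals from later arguments: an infinite neighbourhood, of degree
  \<infinity>, also contains two distinct vertices.\<close>

lemma degree_ge_two_iff:
  assumes "simple_graph G"
  shows "2 \<le> vertex_degree G v \<longleftrightarrow> (\<exists>x y. x \<noteq> y \<and> {x, v} \<in> edges G \<and> {y, v} \<in> edges G)"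
proof -
  define N where "N = {u \<in> vertices G. {u, v} \<in> edges G}"
  have deg: "vertex_degree G v = (if finite N then enat (card N) else \<infinity>)"
    by (simp add: vertex_degree_def N_def Let_def)
  have "2 \<le> vertex_degree G v \<longleftrightarrow> \<not> finite N \<or> 2 \<le> card N"
    by (auto simp: deg numeral_eq_enat)
  also have "\<dots> \<longleftrightarrow> (\<exists>x\<in>N. \<exists>y\<in>N. x \<noteq> y)"
    using card_le_Suc0_iff_eq[of N] by (metis finite.simps all_not_in_conv infinite_imp_nonempty
        not_less_eq_eq numeral_2_eq_2 finite_subset insertI1 insertCI subsetI)
  finally show ?thesis using simple_graph_edgeD[OF assms] unfolding N_def by blast
qed

lemma degree_ge_two_inner:
  assumes "simple_graph G" "vertex_path G (xs @ x # v # y # ys)"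
  shows "v \<in> {v \<in> vertices G. 2 \<le> vertex_degree G v}"
proof -
  have "x \<noteq> y" "v \<in> vertices G" using assms(2) by (auto simp: vertex_path_def)
  moreover have "{x, v} \<in> edges G" "{y, v} \<in> edges G"
    using assms(2) by (auto simp: vertex_path_def successively_append_iff insert_commute)
  ultimately show ?thesis using degree_ge_two_iff[OF assms(1)] by blast
qed

text \<open>Some neighbour of the first vertex differs from the second vertex. It cannot occur later
  on the path either, because the edge to it would be a second path to the same vertex.\<close>

lemma tree_path_extend:
  assumes T: "is_tree T" and vs: "vertex_path T vs" "vs \<noteq> []"
    and deg: "2 \<le> vertex_degree T (hd vs)"
  obtains x where "vertex_path T (x # vs)"
proof -
  have G: "simple_graph T" using T by (simp add: is_tree_def)
  \<comment> \<open>For a one-vertex path \<open>hd (tl vs)\<close> is an unspecified value; one of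
    two distinct neighbours still avoids it.\<close>
  obtain x where x: "{x, hd vs} \<in> edges T" "x \<noteq> hd (tl vs)"
    using deg unfolding degree_ge_two_iff[OF G] by metis
  have xv: "x \<in> vertices T" "x \<noteq> hd vs" using simple_graph_edgeD[OF G x(1)] by auto
  have "x \<notin> set vs"
  proof
    assume "x \<in> set vs"
    then obtain A B where AB: "vs = A @ x # B" by (meson split_list)
    then obtain u A' where A: "A = u # A'" "u = hd vs" using xv by (cases A) auto
    have "vertex_path T (A @ [x])" using vs AB vertex_path_appendD(1)[of T "A @ [x]" B] by simp
    moreover have "vertex_path T [u, x]"
      using x xv A vs by (auto simp: vertex_path_def insert_commute)
    ultimately have "A @ [x] = [u, x]"
      by (rule tree_path_unique[OF T]) (use A in auto)
    then have "vs = u # x # B" using AB by simp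
    then show False using x(2) by simp
  qed
  then show ?thesis using that vs x xv by (simp add: vertex_path_def successively_Cons)
qed

lemma branch_vertices_adjacent:
  assumes T: "is_tree T" and short: "\<And>vs. vertex_path T vs \<Longrightarrow> length vs \<le> 4"
    and "u \<in> vertices T" "v \<in> vertices T" "u \<noteq> v"
    and deg: "2 \<le> vertex_degree T u" "2 \<le> vertex_degree T v"
  shows "{u, v} \<in> edges T"
proof -
  obtain vs where vs: "vertex_path T vs" "2 \<le> length vs" "hd vs = u" "last vs = v"
    using tree_connected assms by metis
  have ne: "vs \<noteq> []" using vs by auto
  obtain x where x: "vertex_path T (x # vs)"
    using tree_path_extend[OF T vs(1) ne] vs deg by metis
  \<comment> \<open>Reversal puts \<open>v\<close> in front, so the same extension applies at the
    other end. The result has \<open>length vs + 2\<close> vertices, which forces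
    \<open>length vs = 2\<close>.\<close>
  obtain y where "vertex_path T (y # rev (x # vs))"
    by (rule tree_path_extend[OF T, of "rev (x # vs)"])
      (use x vs deg ne in \<open>auto simp: vertex_path_rev hd_append hd_rev simp del: rev.simps\<close>)
  then have "length vs = 2" using short vs(2) by fastforce
  then have "vs = [u, v]" using vs by (cases vs; cases "tl vs") auto
  then show ?thesis using vs by (simp add: vertex_path_def)
qed

lemma few_branch_vertices:
  assumes T: "is_tree T" and short: "\<And>vs. vertex_path T vs \<Longrightarrow> length vs \<le> 4"
  defines "D \<equiv> {v \<in> vertices T. 2 \<le> vertex_degree T v}"
  shows "finite D \<and> card D \<le> 2"
proof (rule ccontr)
  assume "\<not> (finite D \<and> card D \<le> 2)"
  \<comment> \<open>Both the infinite and the large finite case provide a three-element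
    subset.\<close>
  then have "infinite D \<or> 3 \<le> card D" by auto
  then obtain S where "S \<subseteq> D" "card S = 3"
    by (metis infinite_arbitrarily_large obtain_subset_with_card_n)
  then obtain a b c where abc: "a \<in> D" "b \<in> D" "c \<in> D" "a \<noteq> b" "b \<noteq> c" "a \<noteq> c"
    by (auto simp: card_3_iff)
  then have "{a, b} \<in> edges T" "{b, c} \<in> edges T" "{c, a} \<in> edges T"
    using branch_vertices_adjacent[OF T short] unfolding D_def by auto
  then show False
    using tree_no_closed_path[OF T, of "[a, b, c]"] abc by (auto simp: vertex_path_def D_def)
qed

text \<open>On a path with five vertices, the second, third and fourth each have two neighbours on
  the path.\<close>

lemma few_branch_vertices_imp_short:
  assumes G: "simple_graph G"
  defines "D \<equiv> {v \<in> vertices G. 2 \<le> vertex_degree G v}"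
  assumes D: "finite D" "card D \<le> 2" and vs: "vertex_path G vs"
  shows "length vs \<le> 4"
proof (rule ccontr)
  assume "\<not> length vs \<le> 4"
  then have "5 \<le> length vs" by simp
  then obtain a b c d e ws where e: "vs = a # b # c # d # e # ws"
    by (auto simp: numeral_eq_Suc Suc_le_length_iff)
  have "b \<in> D" "c \<in> D" "d \<in> D"
    using degree_ge_two_inner[OF G, of "[]" a b c "d # e # ws"]
      degree_ge_two_inner[OF G, of "[a]" b c d "e # ws"]
      degree_ge_two_inner[OF G, of "[a, b]" c d e "ws"] vs e unfolding D_def by auto
  then have "card {b, c, d} \<le> card D" using D by (intro card_mono) auto
  moreover have "card {b, c, d} = 3" using vs e by (auto simp: vertex_path_def)
  ultimately show False using D by simp
qed

section \<open>Star graphs and their distances\<close>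

definition star_graph :: "'a set \<Rightarrow> 'a \<Rightarrow> 'a sgraph" where
  "star_graph V c = \<lparr>vertices = V, edges = {{c, v} | v. v \<in> V - {c}}\<rparr>"

lemma star_graph_simple:
  assumes "c \<in> V"
  shows "simple_graph (star_graph V c)"
  unfolding simple_graph_def
proof
  show "edges (star_graph V c) \<subseteq>
      {{u, v} | u v. u \<in> vertices (star_graph V c) \<and> v \<in> vertices (star_graph V c) \<and> u \<noteq> v}"
    using assms unfolding star_graph_def by force
qed (use assms in \<open>auto simp: star_graph_def\<close>)

lemma is_star_graph_star_graph:
  assumes c: "c \<in> V"
  shows "is_star_graph (star_graph V c)"
proof -
  let ?S = "star_graph V c"
  have S: "simple_graph ?S" using star_graph_simple[OF c] .
  have adj: "{x, y} \<in> edges ?S \<longleftrightarrow> x = c \<and> y \<in> V - {c} \<or> y = c \<and> x \<in> V - {c}" for x y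
    by (auto simp: star_graph_def doubleton_eq_iff)
  have "connected_graph ?S"
    unfolding connected_graph_def
  proof (intro ballI impI)
    fix u v assume uv: "u \<in> vertices ?S" "v \<in> vertices ?S" "u \<noteq> v"
    define vs where "vs = (if u = c \<or> v = c then [u, v] else [u, c, v])"
    have "vertex_path ?S vs" "2 \<le> length vs"
      using uv c by (auto simp: vs_def vertex_path_def adj) (auto simp: star_graph_def)
    then obtain P where "path_numbering P vs" "is_subgraph P ?S"
      using vertex_path_subgraph[OF S] by blast
    then show "\<exists>P. is_subgraph P ?S \<and> path_joins P u v"
      unfolding path_joins_def by (intro exI[of _ P] conjI exI[of _ vs]) (auto simp: vs_def)
  qed
  moreover have "\<not> (is_cycle C \<and> is_subgraph C ?S)" for C
  proof
    assume C: "is_cycle C \<and> is_subgraph C ?S"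
    then obtain vs where vs: "distinct vs" "3 \<le> length vs"
      "edges C = {{vs ! i, vs ! Suc i} | i. Suc i < length vs} \<union> {{last vs, hd vs}}"
      unfolding is_cycle_def by blast
    then obtain x y z zs where xyz: "vs = x # y # z # zs"
      by (auto simp: numeral_eq_Suc Suc_le_length_iff)
    \<comment> \<open>Every edge of the star contains \<open>c\<close>, but no vertex lies on all
      three of these edges of the cycle.\<close>
    have "{vs ! 0, vs ! Suc 0} \<in> edges C" "{vs ! 1, vs ! Suc 1} \<in> edges C" "{last vs, hd vs} \<in> edges C"
      using vs by (fastforce simp: numeral_eq_Suc)+
    then have "{x, y} \<in> edges ?S" "{y, z} \<in> edges ?S" "{last vs, x} \<in> edges ?S"
      using C xyz unfolding is_subgraph_def by auto
    moreover have "last vs \<in> set (z # zs)" using xyz by simp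
    ultimately show False using vs(1) xyz unfolding adj by auto
  qed
  ultimately have "is_tree ?S" using S unfolding is_tree_def by blast
  then show ?thesis using c unfolding is_star_graph_def by (auto simp: star_graph_def)
qed

text \<open>The centre lies on every joining path, as an end or as the only inner vertex, so one
  formula covers both cases.\<close>

lemma label_dist_star:
  assumes S: "is_tree S" and c: "c \<in> vertices S" "edges S = {{c, v} | v. v \<in> vertices S - {c}}"
    and uv: "u \<in> vertices S" "v \<in> vertices S" "u \<noteq> v"
  shows "label_dist S l (u, v) = max (l c) (max (l u) (l v))"
proof -
  have adj: "{x, y} \<in> edges S" if "x = c \<and> y \<in> vertices S - {c} \<or> y = c \<and> x \<in> vertices S - {c}" for x y
    using that unfolding c(2) by blast
  define vs where "vs = (if u = c \<or> v = c then [u, v] else [u, c, v])"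
  have "vertex_path S vs" "2 \<le> length vs"
    using uv c(1) by (auto simp: vs_def vertex_path_def intro!: adj)
  from label_dist_path[OF S this, of l] show ?thesis
    by (auto simp: vs_def split: if_splits)
qed

section \<open>Spaces generated by trees and by stars\<close>

lemma short_paths_of_generated_subset:
  assumes T: "is_tree T" and sub: "generated_spaces T \<subseteq> star_generated_spaces"
    and vs: "vertex_path T vs"
  shows "length vs \<le> 4"
proof (rule ccontr)
  assume "\<not> length vs \<le> 4"
  then have "5 \<le> length vs" by simp
  then obtain a b c d e ws where e: "vs = a # b # c # d # e # ws"
    by (auto simp: numeral_eq_Suc Suc_le_length_iff)
  have V: "{a, b, c, d, e} \<subseteq> vertices T" and ne: "distinct [a, b, c, d, e]"
    using vs e by (auto simp: vertex_path_def)
  have p: "vertex_path T [a, b]" "vertex_path T [d, e]" "vertex_path T [a, b, c, d]"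
    using vs e by (auto simp: vertex_path_def)
  \<comment> \<open>The large label sits between the two end edges, on the path from
    \<open>a\<close> to \<open>d\<close>; positive labels everywhere ensure non-degeneracy.\<close>
  define l :: "'a \<Rightarrow> real" where "l = restrict (\<lambda>x. if x = c then 2 else 1) (vertices T)"
  have "simple_graph T" using T by (simp add: is_tree_def)
  then have "l \<in> nondegenerate_labelings T"
    unfolding nondegenerate_labelings_def labelings_def l_def
    using simple_graph_edgeD[of T] by (auto simp: less_max_iff_disj)
  then have "(vertices T, label_dist T l) \<in> star_generated_spaces"
    using sub unfolding generated_spaces_def by blast
  then obtain S m z where S: "is_tree S" "z \<in> vertices S"
      "edges S = {{z, v} | v. v \<in> vertices S - {z}}" "vertices S = vertices T"
      "label_dist T l = label_dist S m"
    unfolding star_generated_spaces_def is_star_graph_def by auto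
  have star: "label_dist T l (u, v) = max (m z) (max (m u) (m v))"
    if "u \<in> vertices T" "v \<in> vertices T" "u \<noteq> v" for u v
    using label_dist_star[OF S(1-3)] that S(4,5) by simp
  have "label_dist T l (a, b) = 1" "label_dist T l (d, e) = 1" "label_dist T l (a, d) = 2"
    using label_dist_path[OF T p(1)] label_dist_path[OF T p(2)] label_dist_path[OF T p(3)] V ne
    by (auto simp: l_def)
  \<comment> \<open>The two distances 1 bound \<open>m z\<close>, \<open>m a\<close> and
    \<open>m d\<close> by 1, so \<open>a\<close> and \<open>d\<close> would be at distance at most
    1.\<close>
  then show False using star V ne by (auto simp: max_def split: if_splits)
qed

text \<open>Every other vertex is adjacent to \<open>c\<close> or hangs on the only other vertex
  \<open>a\<close> of degree at least two. For two vertices hanging on \<open>a\<close> the path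
  avoids \<open>c\<close>, but the extra term \<open>l c\<close> is absorbed because
  \<open>l c \<le> l a\<close>; this is why the centre takes the smaller label.\<close>

lemma label_dist_branch_center:
  assumes T: "is_tree T" and c: "c \<in> vertices T"
    and D: "finite {v \<in> vertices T. 2 \<le> vertex_degree T v}"
      "card {v \<in> vertices T. 2 \<le> vertex_degree T v} \<le> 2"
    and min: "\<And>v. v \<in> vertices T \<Longrightarrow> 2 \<le> vertex_degree T v \<Longrightarrow> 2 \<le> vertex_degree T c \<and> l c \<le> l v"
    and uv: "u \<in> vertices T" "v \<in> vertices T" "u \<noteq> v"
  defines "m \<equiv> \<lambda>x. if x = c then l c else label_dist T l (x, c)"
  shows "label_dist T l (u, v) = max (l c) (max (m u) (m v))"
proof -
  have G: "simple_graph T" using T by (simp add: is_tree_def)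
  let ?D = "{v \<in> vertices T. 2 \<le> vertex_degree T v}"
  have D3: "x = y \<or> x = c \<or> y = c" if "x \<in> ?D" "y \<in> ?D" for x y
  proof (rule ccontr)
    assume *: "\<not> (x = y \<or> x = c \<or> y = c)"
    have "c \<in> ?D" using min that c by blast
    then have "card {x, y, c} \<le> card ?D" using that D by (intro card_mono) auto
    then show False using * D by auto
  qed
  \<comment> \<open>Inner vertices of the path from \<open>x\<close> to \<open>c\<close> have degree
    at least two and differ from \<open>c\<close>, so by \<open>D3\<close> there is at most one. In
    the second case \<open>l a\<close> absorbs \<open>l c\<close> in the maximum.\<close>
  have near: "{x, c} \<in> edges T \<and> m x = max (l x) (l c) \<or>
      (\<exists>a\<in>?D. a \<noteq> c \<and> {x, a} \<in> edges T \<and> {a, c} \<in> edges T \<and> l c \<le> l a \<and> m x = max (l x) (l a))"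
    if x: "x \<in> vertices T" "x \<noteq> c" for x
  proof -
    obtain vs where vs: "vertex_path T vs" "2 \<le> length vs" "hd vs = x" "last vs = c"
      using tree_connected[OF T x(1) c x(2)] by metis
    have mx: "m x = Max (l ` set vs)"
      using label_dist_path[OF T vs(1,2), of l] vs x by (simp add: m_def)
    obtain y ws where y: "vs = x # y # ws" using vs by (cases vs; cases "tl vs") auto
    show ?thesis
    proof (cases ws)
      case Nil
      then show ?thesis using vs y mx by (auto simp: vertex_path_def)
    next
      case (Cons z zs)
      have yD: "y \<in> ?D"
        using degree_ge_two_inner[OF G, of "[]" x y z zs] vs y Cons by simp
      have "zs = []"
      proof (rule ccontr)
        assume "zs \<noteq> []"
        then obtain w us where zs: "zs = w # us" by (cases zs) auto
        have "z \<in> ?D" using degree_ge_two_inner[OF G, of "[x]" y z w us] vs y Cons zs by simp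
        moreover have "c \<in> set zs" using vs y Cons zs by (auto simp: last_in_set)
        ultimately show False using D3[OF yD, of z] vs y Cons by (auto simp: vertex_path_def)
      qed
      then have "vs = [x, y, c]" using vs y Cons by simp
      then have "y \<noteq> c" "{x, y} \<in> edges T" "{y, c} \<in> edges T" "m x = max (l x) (max (l y) (l c))"
        using vs mx by (auto simp: vertex_path_def)
      moreover have "l c \<le> l y" using yD min by blast
      ultimately show ?thesis using yD by (intro disjI2 bexI[of _ y]) simp_all
    qed
  qed
  have d: "label_dist T l (hd vs, last vs) = Max (l ` set vs)"
    if "vertex_path T vs" "2 \<le> length vs" for vs
    using label_dist_path[OF T that] .
  have sym: "{y, x} \<in> edges T" if "{x, y} \<in> edges T" for x y
    using that by (simp add: insert_commute)
  have center: "label_dist T l (x, c) = max (l c) (max (m x) (m c))"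
    if x: "x \<in> vertices T" "x \<noteq> c" for x
  proof -
    have "l c \<le> m x" using near[OF x] by auto
    then show ?thesis using x by (simp add: m_def max_def)
  qed
  have commute: "label_dist T l (x, y) = label_dist T l (y, x)"
    if xy: "x \<in> vertices T" "y \<in> vertices T" "x \<noteq> y" for x y
  proof -
    obtain vs where vs: "vertex_path T vs" "2 \<le> length vs" "hd vs = x" "last vs = y"
      using tree_connected[OF T xy] by metis
    moreover have "vs \<noteq> []" using vs by auto
    ultimately show ?thesis
      using d[of vs] d[of "rev vs"] by (simp add: vertex_path_rev hd_rev last_rev)
  qed
  \<comment> \<open>The path is \<open>x, a, c, y\<close> in general, but just the edge
    \<open>x, y\<close> if \<open>y\<close> is \<open>a\<close> itself; then \<open>l a\<close>
    again absorbs \<open>l c\<close>.\<close>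
  have mixed: "label_dist T l (x, y) = max (l c) (max (m x) (m y))"
    if xy: "x \<noteq> y" "x \<noteq> c" "y \<noteq> c" "x \<in> vertices T" "y \<in> vertices T"
      and x: "a \<in> ?D" "a \<noteq> c" "{x, a} \<in> edges T" "{a, c} \<in> edges T" "l c \<le> l a" "m x = max (l x) (l a)"
      and y: "{y, c} \<in> edges T" "m y = max (l y) (l c)" for x y a
  proof (cases "y = a")
    case True
    then show ?thesis using d[of "[x, y]"] xy x y by (auto simp: vertex_path_def)
  next
    case False
    moreover have "x \<noteq> a" using simple_graph_edgeD(3)[OF G x(3)] .
    ultimately show ?thesis
      using d[of "[x, a, c, y]"] xy x y c sym[OF y(1)]
      by (auto simp: vertex_path_def ac_simps)
  qed
  show ?thesis
  proof (cases "u = c \<or> v = c")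
    case True
    then show ?thesis using center uv commute by (metis max.commute)
  next
    case False
    then have uc: "u \<noteq> c" and vc: "v \<noteq> c" by auto
    from near[OF uv(1) uc] near[OF uv(2) vc] show ?thesis
    proof (elim disjE bexE conjE)
      assume "{u, c} \<in> edges T" "m u = max (l u) (l c)" "{v, c} \<in> edges T" "m v = max (l v) (l c)"
      then show ?thesis using d[of "[u, c, v]"] uv uc vc c sym
        by (auto simp: vertex_path_def ac_simps)
    next
      fix a assume "a \<in> ?D" "a \<noteq> c" "{v, a} \<in> edges T" "{a, c} \<in> edges T" "l c \<le> l a"
        "m v = max (l v) (l a)" "{u, c} \<in> edges T" "m u = max (l u) (l c)"
      then have "label_dist T l (v, u) = max (l c) (max (m v) (m u))"
        using mixed[of v u a] uv uc vc by blast
      then show ?thesis using commute[OF uv] by (simp add: max.commute)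
    next
      fix a assume "a \<in> ?D" "a \<noteq> c" "{u, a} \<in> edges T" "{a, c} \<in> edges T" "l c \<le> l a"
        "m u = max (l u) (l a)" "{v, c} \<in> edges T" "m v = max (l v) (l c)"
      then show ?thesis using mixed[of u v a] uv uc vc by blast
    next
      fix a b assume ab: "a \<in> ?D" "a \<noteq> c" "b \<in> ?D" "b \<noteq> c"
        and e: "{u, a} \<in> edges T" "{v, b} \<in> edges T" "l c \<le> l a"
        "m u = max (l u) (l a)" "m v = max (l v) (l b)"
      have "a = b" using D3[of a b] ab by blast
      then have "label_dist T l (u, v) = max (l u) (max (l a) (l v))"
        using d[of "[u, a, v]"] uv ab e sym[OF e(2)]
          simple_graph_edgeD(3)[OF G e(1)] simple_graph_edgeD(3)[OF G e(2)]
        by (auto simp: vertex_path_def)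
      then show ?thesis unfolding e \<open>a = b\<close>[symmetric] using e(3) by linarith
    qed
  qed
qed

lemma generated_subset_of_few_branch_vertices:
  assumes T: "is_tree T"
    and D: "finite {v \<in> vertices T. 2 \<le> vertex_degree T v}"
      "card {v \<in> vertices T. 2 \<le> vertex_degree T v} \<le> 2"
  shows "generated_spaces T \<subseteq> star_generated_spaces"
proof
  fix X assume "X \<in> generated_spaces T"
  then obtain l where X: "X = (vertices T, label_dist T l)" and l: "l \<in> nondegenerate_labelings T"
    unfolding generated_spaces_def by blast
  let ?D = "{v \<in> vertices T. 2 \<le> vertex_degree T v}" and ?d = "label_dist T l"
  have ne: "vertices T \<noteq> {}" using T by (simp add: is_tree_def simple_graph_def)
  have l0: "0 \<le> l v" if "v \<in> vertices T" for v
    using l that unfolding nondegenerate_labelings_def labelings_def by auto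
  \<comment> \<open>If no vertex has degree at least two, the condition is vacuous and any vertex
    serves; otherwise the finite set \<open>?D\<close> has a member of least label.\<close>
  have "\<exists>c\<in>vertices T. \<forall>v\<in>?D. 2 \<le> vertex_degree T c \<and> l c \<le> l v"
  proof (cases "?D = {}")
    case False
    then have "arg_min_on l ?D \<in> ?D" "\<forall>v\<in>?D. l (arg_min_on l ?D) \<le> l v"
      using D arg_min_if_finite(1)[of ?D l] arg_min_least[of ?D _ l] by blast+
    then show ?thesis by blast
  qed (use ne in auto)
  then obtain c where c: "c \<in> vertices T"
    and min: "\<And>v. v \<in> vertices T \<Longrightarrow> 2 \<le> vertex_degree T v \<Longrightarrow> 2 \<le> vertex_degree T c \<and> l c \<le> l v"
    by blast
  define m where "m = (\<lambda>x. if x = c then l c else ?d (x, c))"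
  have eq: "?d (u, v) = max (l c) (max (m u) (m v))"
    if "u \<in> vertices T" "v \<in> vertices T" "u \<noteq> v" for u v
    unfolding m_def using label_dist_branch_center[where l = l, OF T c D min that] by blast
  have pos: "0 < ?d (u, v)" if "u \<in> vertices T" "v \<in> vertices T" "u \<noteq> v" for u v
    using label_dist_pos[OF T l that] .
  have zero: "?d (u, u) = 0" if "u \<in> vertices T" for u
    using that by (simp add: label_dist_def)
  have "?d \<in> vertices T \<times> vertices T \<rightarrow>\<^sub>E {0..}"
  proof
    fix p assume "p \<in> vertices T \<times> vertices T"
    then show "?d p \<in> {0..}" using pos zero by (cases p; cases "fst p = snd p") (auto intro: less_imp_le)
  qed (auto simp: label_dist_def)
  moreover have "?d (x, y) = ?d (y, x)" if "x \<in> vertices T" "y \<in> vertices T" for x y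
    using eq[of x y] eq[of y x] that by (cases "x = y") (auto simp: max.commute)
  moreover have "?d (x, y) = 0 \<longleftrightarrow> x = y" if "x \<in> vertices T" "y \<in> vertices T" for x y
    using pos[OF that] zero that by force
  moreover have "?d (x, y) \<le> max (?d (x, z)) (?d (z, y))"
    if "x \<in> vertices T" "y \<in> vertices T" "z \<in> vertices T" for x y z
  \<comment> \<open>The formula \<open>eq\<close> holds for distinct points only, so coincidences
    are treated apart. For three distinct points each term on the left occurs on the right.\<close>
  proof (cases "x = y \<or> x = z \<or> z = y")
    case True
    then show ?thesis using that zero pos by (cases "x = z"; cases "z = y") (fastforce simp: le_max_iff_disj)+
  next
    case False
    then show ?thesis using eq that by (simp add: max_def)
  qed
  ultimately have ultra: "is_ultrametric (vertices T) ?d"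
    using ne unfolding is_ultrametric_def by blast
  let ?S = "star_graph (vertices T) c"
  have S: "is_star_graph ?S" using is_star_graph_star_graph[OF c] .
  have mS: "restrict m (vertices T) \<in> labelings ?S"
    unfolding labelings_def using l0 less_imp_le[OF pos] c
    by (auto simp: m_def star_graph_def)
  have "?d = label_dist ?S (restrict m (vertices T))"
  proof
    fix p :: "'a \<times> 'a"
    obtain u v where p: "p = (u, v)" by fastforce
    \<comment> \<open>The cases are off the diagonal, on it, and outside the vertex set, where both
      extensional functions are \<open>undefined\<close>.\<close>
    consider "u \<in> vertices T \<and> v \<in> vertices T \<and> u \<noteq> v" | "u \<in> vertices T \<and> v = u"
      | "\<not> (u \<in> vertices T \<and> v \<in> vertices T)" by blast
    then show "?d p = label_dist ?S (restrict m (vertices T)) p"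
    proof cases
      case 1
      have "label_dist ?S (restrict m (vertices T)) (u, v) = max (m c) (max (m u) (m v))"
        using label_dist_star[of ?S c u v "restrict m (vertices T)"] S c 1
        by (simp add: is_star_graph_def) (simp add: star_graph_def)
      then show ?thesis using p 1 eq by (simp add: m_def)
    next
      case 2
      then show ?thesis using p by (simp add: label_dist_def star_graph_def)
    next
      case 3
      then show ?thesis using p by (auto simp: label_dist_def star_graph_def)
    qed
  qed
  moreover have "vertices ?S = vertices T" by (simp add: star_graph_def)
  ultimately show "X \<in> star_generated_spaces"
    unfolding X star_generated_spaces_def using ultra S mS by auto
qed

theorem theorem3p4:
  fixes T :: "'a sgraph"
  assumes "is_tree T"
  shows "(generated_spaces T \<subseteq> star_generated_spaces \<longleftrightarrow>
            (\<forall>P. is_path P \<and> is_subgraph P T \<longrightarrow> card (edges P) \<le> 3))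
       \<and> ((\<forall>P. is_path P \<and> is_subgraph P T \<longrightarrow> card (edges P) \<le> 3) \<longleftrightarrow>
            (finite {v \<in> vertices T. vertex_degree T v \<ge> 2} \<and>
             card {v \<in> vertices T. vertex_degree T v \<ge> 2} \<le> 2))"
proof -
  have G: "simple_graph T" using assms by (simp add: is_tree_def)
  \<comment> \<open>The implications used are (i) to (ii), (ii) to (iii), (iii) to (ii) and (iii) to
    (i).\<close>
  show ?thesis
    unfolding paths_at_most_three_edges_iff[OF G]
    using short_paths_of_generated_subset[OF assms] few_branch_vertices[OF assms]
      few_branch_vertices_imp_short[OF G] generated_subset_of_few_branch_vertices[OF assms]
    by blast
qed

end
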